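(* For every double Boolean algebra $\mathbf D$, the topological spaces $(\mathcal F_{pr}(\mathbf D),\mathcal T)$ and $(\mathcal I_{pr}(\mathbf D),\mathcal J)$ are compact and totally disconnected; hence both are Hausdorff.
   Context: A double Boolean algebra (dBa) is an algebra $\mathbf{D}=(D,\sqcup,\sqcap,\neg,\lrcorner,\top,\bot)$ of type $(2,2,1,1,0,0)$ such that, with $x\vee y:=\neg(\neg x\sqcap\neg y)$ and $x\wedge y:=\lrcorner(\lrcorner x\sqcup\lrcorner y)$, for all $x,y,z\in D$: $(x\sqcap x)\sqcap y=x\sqcap y$; $x\sqcap y=y\sqcap x$; $x\sqcap(y\sqcap z)=(x\sqcap y)\sqcap z$; $\neg(x\sqcap x)=\neg x$; $x\sqcap(x\sqcup y)=x\sqcap x$; $x\sqcap(y\vee z)=(x\sqcap y)\vee(x\sqcap z)$; $x\sqcap(x\vee y)=x\sqcap x$; $\neg\neg(x\sqcap y)=x\sqcap y$; $x\sqcap\neg x=\bot$; $\neg\bot=\top\sqcap\top$; $\neg\top=\bot$; the duals $(x\sqcup x)\sqcup y=x\sqcup y$; $x\sqcup y=y\sqcup x$; $x\sqcup(y\sqcup z)=(x\sqcup y)\sqcup z$; $\lrcorner(x\sqcup x)=\lrcorner x$; $x\sqcup(x\sqcap y)=x\sqcup x$; $x\sqcup(y\wedge z)=(x\sqcup y)\wedge(x\sqcup z)$; $x\sqcup(x\wedge y)=x\sqcup x$; $\lrcorner\lrcorner(x\sqcup y)=x\sqcup y$; $x\sqcup\lrcorner x=\top$; $\lrcorner\top=\bot\sqcup\bot$;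 $\lrcorner\bot=\top$; and $(x\sqcap x)\sqcup(x\sqcap x)=(x\sqcup x)\sqcap(x\sqcup x)$. The quasi-order is $x\sqsubseteq y$ iff $x\sqcap y=x\sqcap x$ and $x\sqcup y=y\sqcup y$. A filter is $F\subseteq D$ closed under $\sqcap$ and upward closed for $\sqsubseteq$; an ideal is $I\subseteq D$ closed under $\sqcup$ and downward closed. A primary filter is a filter $F\ne D$ with $x\in F$ or $\neg x\in F$ for all $x$; a primary ideal is an ideal $I\ne D$ with $x\in I$ or $\lrcorner x\in I$ for all $x$. $\mathcal F_{pr}(\mathbf D)$, $\mathcal I_{pr}(\mathbf D)$ are the sets of primary filters and ideals; $F_x:=\{F\in\mathcal F_{pr}(\mathbf D):x\in F\}$, $I_x:=\{I\in\mathcal I_{pr}(\mathbf D):x\in I\}$. $\mathcal T$ is the topology on $\mathcal F_{pr}(\mathbf D)$ having $\{F_x:x\in D\}$ as a subbase of closed sets, and $\mathcal J$ the topology on $\mathcal I_{pr}(\mathbf D)$ having $\{I_x:x\in D\}$ as a subbase of closed sets. A space is totally disconnected if any two distinct points are separated by a clopen set. *)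

theory Defs
  imports "HOL-Analysis.Analysis" "HOL-Algebra.Congruence"
begin

record 'a dba = "'a partial_object" +
  djoin :: "['a, 'a] \<Rightarrow> 'a" (infixl \<open>\<squnion>\<index>\<close> 65)
  dmeet :: "['a, 'a] \<Rightarrow> 'a" (infixl \<open>\<sqinter>\<index>\<close> 70)
  dneg :: "'a \<Rightarrow> 'a" (\<open>\<^bold>\<not>\<index> _\<close> [81] 80)
  dopp :: "'a \<Rightarrow> 'a" (\<open>\<^bold>\<rfloor>\<index> _\<close> [81] 80)
  dtop :: 'a (\<open>\<top>\<index>\<close>)
  dbot :: 'a (\<open>\<bottom>\<index>\<close>)

definition dvee :: "[('a, 'm) dba_scheme, 'a, 'a] \<Rightarrow> 'a" (infixl \<open>\<^bold>\<or>\<index>\<close> 65)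
  where "x \<^bold>\<or>\<^bsub>D\<^esub> y = \<^bold>\<not>\<^bsub>D\<^esub> (\<^bold>\<not>\<^bsub>D\<^esub> x \<sqinter>\<^bsub>D\<^esub> \<^bold>\<not>\<^bsub>D\<^esub> y)"

definition dwedge :: "[('a, 'm) dba_scheme, 'a, 'a] \<Rightarrow> 'a" (infixl \<open>\<^bold>\<and>\<index>\<close> 70)
  where "x \<^bold>\<and>\<^bsub>D\<^esub> y = \<^bold>\<rfloor>\<^bsub>D\<^esub> (\<^bold>\<rfloor>\<^bsub>D\<^esub> x \<squnion>\<^bsub>D\<^esub> \<^bold>\<rfloor>\<^bsub>D\<^esub> y)"

locale double_boolean_algebra =
  fixes D :: "('a, 'm) dba_scheme" (structure)
  assumes join_closed: "\<lbrakk>x \<in> carrier D; y \<in> carrier D\<rbrakk> \<Longrightarrow> x \<squnion> y \<in> carrier D"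
    and meet_closed: "\<lbrakk>x \<in> carrier D; y \<in> carrier D\<rbrakk> \<Longrightarrow> x \<sqinter> y \<in> carrier D"
    and neg_closed: "x \<in> carrier D \<Longrightarrow> \<^bold>\<not> x \<in> carrier D"
    and opp_closed: "x \<in> carrier D \<Longrightarrow> \<^bold>\<rfloor> x \<in> carrier D"
    and top_closed: "\<top> \<in> carrier D"
    and bot_closed: "\<bottom> \<in> carrier D"
    and meet_idem_left: "\<lbrakk>x \<in> carrier D; y \<in> carrier D\<rbrakk> \<Longrightarrow> (x \<sqinter> x) \<sqinter> y = x \<sqinter> y"
    and meet_comm: "\<lbrakk>x \<in> carrier D; y \<in> carrier D\<rbrakk> \<Longrightarrow> x \<sqinter> y = y \<sqinter> x"
    and meet_assoc: "\<lbrakk>x \<in> carrier D; y \<in> carrier D; z \<in> carrier D\<rbrakk> \<Longrightarrow>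
          x \<sqinter> (y \<sqinter> z) = (x \<sqinter> y) \<sqinter> z"
    and neg_meet_idem: "x \<in> carrier D \<Longrightarrow> \<^bold>\<not> (x \<sqinter> x) = \<^bold>\<not> x"
    and meet_join_absorb: "\<lbrakk>x \<in> carrier D; y \<in> carrier D\<rbrakk> \<Longrightarrow> x \<sqinter> (x \<squnion> y) = x \<sqinter> x"
    and meet_vee_distrib: "\<lbrakk>x \<in> carrier D; y \<in> carrier D; z \<in> carrier D\<rbrakk> \<Longrightarrow>
          x \<sqinter> (y \<^bold>\<or> z) = (x \<sqinter> y) \<^bold>\<or> (x \<sqinter> z)"
    and meet_vee_absorb: "\<lbrakk>x \<in> carrier D; y \<in> carrier D\<rbrakk> \<Longrightarrow> x \<sqinter> (x \<^bold>\<or> y) = x \<sqinter> x"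
    and neg_neg_meet: "\<lbrakk>x \<in> carrier D; y \<in> carrier D\<rbrakk> \<Longrightarrow> \<^bold>\<not> (\<^bold>\<not> (x \<sqinter> y)) = x \<sqinter> y"
    and meet_neg: "x \<in> carrier D \<Longrightarrow> x \<sqinter> \<^bold>\<not> x = \<bottom>"
    and neg_bot: "\<^bold>\<not> \<bottom> = \<top> \<sqinter> \<top>"
    and neg_top: "\<^bold>\<not> \<top> = \<bottom>"
    and join_idem_left: "\<lbrakk>x \<in> carrier D; y \<in> carrier D\<rbrakk> \<Longrightarrow> (x \<squnion> x) \<squnion> y = x \<squnion> y"
    and join_comm: "\<lbrakk>x \<in> carrier D; y \<in> carrier D\<rbrakk> \<Longrightarrow> x \<squnion> y = y \<squnion> x"
    and join_assoc: "\<lbrakk>x \<in> carrier D; y \<in> carrier D; z \<in> carrier D\<rbrakk> \<Longrightarrow>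
          x \<squnion> (y \<squnion> z) = (x \<squnion> y) \<squnion> z"
    and opp_join_idem: "x \<in> carrier D \<Longrightarrow> \<^bold>\<rfloor> (x \<squnion> x) = \<^bold>\<rfloor> x"
    and join_meet_absorb: "\<lbrakk>x \<in> carrier D; y \<in> carrier D\<rbrakk> \<Longrightarrow> x \<squnion> (x \<sqinter> y) = x \<squnion> x"
    and join_wedge_distrib: "\<lbrakk>x \<in> carrier D; y \<in> carrier D; z \<in> carrier D\<rbrakk> \<Longrightarrow>
          x \<squnion> (y \<^bold>\<and> z) = (x \<squnion> y) \<^bold>\<and> (x \<squnion> z)"
    and join_wedge_absorb: "\<lbrakk>x \<in> carrier D; y \<in> carrier D\<rbrakk> \<Longrightarrow> x \<squnion> (x \<^bold>\<and> y) = x \<squnion> x"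
    and opp_opp_join: "\<lbrakk>x \<in> carrier D; y \<in> carrier D\<rbrakk> \<Longrightarrow> \<^bold>\<rfloor> (\<^bold>\<rfloor> (x \<squnion> y)) = x \<squnion> y"
    and join_opp: "x \<in> carrier D \<Longrightarrow> x \<squnion> \<^bold>\<rfloor> x = \<top>"
    and opp_top: "\<^bold>\<rfloor> \<top> = \<bottom> \<squnion> \<bottom>"
    and opp_bot: "\<^bold>\<rfloor> \<bottom> = \<top>"
    and meet_join_idem: "x \<in> carrier D \<Longrightarrow>
          (x \<sqinter> x) \<squnion> (x \<sqinter> x) = (x \<squnion> x) \<sqinter> (x \<squnion> x)"

definition dle :: "[('a, 'm) dba_scheme, 'a, 'a] \<Rightarrow> bool" (infix \<open>\<sqsubseteq>\<index>\<close> 50)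
  where "x \<sqsubseteq>\<^bsub>D\<^esub> y \<longleftrightarrow> x \<sqinter>\<^bsub>D\<^esub> y = x \<sqinter>\<^bsub>D\<^esub> x \<and> x \<squnion>\<^bsub>D\<^esub> y = y \<squnion>\<^bsub>D\<^esub> y"

definition dba_filter :: "('a, 'm) dba_scheme \<Rightarrow> 'a set \<Rightarrow> bool"
  where "dba_filter D F \<longleftrightarrow> F \<subseteq> carrier D \<and>
    (\<forall>x\<in>F. \<forall>y\<in>F. x \<sqinter>\<^bsub>D\<^esub> y \<in> F) \<and>
    (\<forall>x\<in>F. \<forall>y\<in>carrier D. x \<sqsubseteq>\<^bsub>D\<^esub> y \<longrightarrow> y \<in> F)"

definition dba_ideal :: "('a, 'm) dba_scheme \<Rightarrow> 'a set \<Rightarrow> bool"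
  where "dba_ideal D I \<longleftrightarrow> I \<subseteq> carrier D \<and>
    (\<forall>x\<in>I. \<forall>y\<in>I. x \<squnion>\<^bsub>D\<^esub> y \<in> I) \<and>
    (\<forall>x\<in>I. \<forall>y\<in>carrier D. y \<sqsubseteq>\<^bsub>D\<^esub> x \<longrightarrow> y \<in> I)"

definition primary_filters :: "('a, 'm) dba_scheme \<Rightarrow> 'a set set"
  where "primary_filters D =
    {F. dba_filter D F \<and> F \<noteq> carrier D \<and> (\<forall>x\<in>carrier D. x \<in> F \<or> \<^bold>\<not>\<^bsub>D\<^esub> x \<in> F)}"

definition primary_ideals :: "('a, 'm) dba_scheme \<Rightarrow> 'a set set"
  where "primary_ideals D =
    {I. dba_ideal D I \<and> I \<noteq> carrier D \<and> (\<forall>x\<in>carrier D. x \<in> I \<or> \<^bold>\<rfloor>\<^bsub>D\<^esub> x \<in> I)}"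

definition primary_filters_at :: "('a, 'm) dba_scheme \<Rightarrow> 'a \<Rightarrow> 'a set set"
  where "primary_filters_at D x = {F \<in> primary_filters D. x \<in> F}"

definition primary_ideals_at :: "('a, 'm) dba_scheme \<Rightarrow> 'a \<Rightarrow> 'a set set"
  where "primary_ideals_at D x = {I \<in> primary_ideals D. x \<in> I}"

text \<open>The coarsest topology on \<open>X\<close> in which every member of \<open>\<C>\<close> is closed. Taking finite
  intersections relative to \<open>X\<close> makes \<open>X\<close> the underlying set even if the complements do not
  cover it.\<close>

definition closed_subbase_topology :: "'b set \<Rightarrow> 'b set set \<Rightarrow> 'b topology"
  where "closed_subbase_topology X \<C> =
    topology (arbitrary union_of
      (finite intersection_of (\<lambda>U. U \<in> (\<lambda>C. X - C) ` \<C>) relative_to X))"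

lemma topspace_closed_subbase_topology: "topspace (closed_subbase_topology X \<C>) = X"
  unfolding closed_subbase_topology_def by (rule topspace_subbase)

lemma closedin_closed_subbase_topology:
  assumes "C \<in> \<C>" "C \<subseteq> X"
  shows "closedin (closed_subbase_topology X \<C>) C"
proof -
  have "(finite intersection_of (\<lambda>U. U \<in> (\<lambda>C. X - C) ` \<C>) relative_to X) (X \<inter> (X - C))"
    using assms(1) by (intro relative_to_inc finite_intersection_of_inc) auto
  then have "openin (closed_subbase_topology X \<C>) (X \<inter> (X - C))"
    unfolding closed_subbase_topology_def openin_subbase by (rule arbitrary_union_of_inc)
  then show ?thesis
    using assms(2)
    by (simp add: closedin_def topspace_closed_subbase_topology Int_absorb1 Diff_subset)
qed

definition primary_filter_space :: "('a, 'm) dba_scheme \<Rightarrow> 'a set topology"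
  where "primary_filter_space D =
    closed_subbase_topology (primary_filters D) (primary_filters_at D ` carrier D)"

definition primary_ideal_space :: "('a, 'm) dba_scheme \<Rightarrow> 'a set topology"
  where "primary_ideal_space D =
    closed_subbase_topology (primary_ideals D) (primary_ideals_at D ` carrier D)"

text \<open>Separation of points by clopen sets; some authors call this totally separated.\<close>

definition totally_disconnected_space :: "'b topology \<Rightarrow> bool"
  where "totally_disconnected_space X \<longleftrightarrow>
    (\<forall>x\<in>topspace X. \<forall>y\<in>topspace X. x \<noteq> y \<longrightarrow>
      (\<exists>U. openin X U \<and> closedin X U \<and> x \<in> U \<and> y \<notin> U))"

end

theory Submission
  imports Defs
begin

text \<open>
  Since \<open>\<bottom>\<close> lies below every element, a filter is proper iff it omits \<open>\<bottom>\<close>. Hence being a primary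
  filter is a conjunction of conditions each involving only finitely many elements, so the primary
  filters form a closed subset of the Cantor space of all subsets of the carrier, and Tychonoff's
  theorem gives compactness without any appeal to a prime filter theorem. A primary filter contains
  exactly one of \<open>x\<close> and \<open>\<not> x\<close>, so the subbasic closed sets are clopen and separate points.
  The ideals of an algebra are the filters of its order dual.
\<close>

section \<open>General topology: closed subbases, compactness, separation\<close>

lemma continuous_map_into_closed_subbase_topology:
  assumes f: "f \<in> topspace T \<rightarrow> X"
    and cl: "\<And>C. C \<in> \<C> \<Longrightarrow> closedin T {x \<in> topspace T. f x \<in> C}"
  shows "continuous_map T (closed_subbase_topology X \<C>) f"
  unfolding closed_subbase_topology_def
proof (rule continuous_map_into_topology_subbase)
  show "f x \<in> topspace (topology (arbitrary union_of
      (finite intersection_of (\<lambda>U. U \<in> (\<lambda>C. X - C) ` \<C>) relative_to X)))"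
    if "x \<in> topspace T" for x
    using f that by (auto simp only: topspace_subbase)
  fix U assume "U \<in> (\<lambda>C. X - C) ` \<C>"
  then obtain C where C: "C \<in> \<C>" "U = X - C" by blast
  \<comment> \<open>As \<open>f\<close> maps into \<open>X\<close>, the preimage of the relative
    complement of \<open>C\<close> is the complement of the preimage of \<open>C\<close>.\<close>
  then have "{x \<in> topspace T. f x \<in> U} = topspace T - {x \<in> topspace T. f x \<in> C}"
    using f by auto
  then show "openin T {x \<in> topspace T. f x \<in> U}"
    using cl [OF C(1)] by (simp add: openin_diff)
qed

text \<open>By \<open>finitary\<close>, every subset of \<open>A\<close> outside \<open>X\<close>
  has a whole Cantor-space neighbourhood outside \<open>X\<close>. So \<open>X\<close> is closed,
  hence compact, in the Cantor space, and the topology with the given closed subbase is a continuous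
  image of it.\<close>

lemma compact_space_set_family:
  assumes sub: "X \<subseteq> Pow A"
    and finitary: "\<And>F. \<lbrakk>F \<subseteq> A; F \<notin> X\<rbrakk> \<Longrightarrow>
      \<exists>S. finite S \<and> S \<subseteq> A \<and> (\<forall>G. G \<subseteq> A \<longrightarrow> G \<inter> S = F \<inter> S \<longrightarrow> G \<notin> X)"
  shows "compact_space (closed_subbase_topology X ((\<lambda>x. {F \<in> X. x \<in> F}) ` A))"
proof -
  \<comment> \<open>Subsets of \<open>A\<close> are coded by their characteristic functions;
    \<open>set_of\<close> decodes and \<open>K\<close> holds the codes of members of
    \<open>X\<close>.\<close>
  define T where "T = product_topology (\<lambda>_. discrete_topology (UNIV :: bool set)) A"
  define set_of where "set_of f = {x \<in> A. f x}" for f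
  define K where "K = {f \<in> topspace T. set_of f \<in> X}"
  have topT: "topspace T = A \<rightarrow>\<^sub>E UNIV"
    by (simp add: T_def)
  have cylinder: "openin T {g \<in> topspace T. \<forall>x\<in>S. g x = f x}" if "finite S" "S \<subseteq> A" for S f
  proof -
    have "openin T (\<Pi>\<^sub>E x\<in>A. if x \<in> S then {f x} else UNIV)"
      unfolding T_def
      by (rule product_topology_basis) (auto intro: finite_subset [OF _ that(1)])
    moreover have "(\<Pi>\<^sub>E x\<in>A. if x \<in> S then {f x} else UNIV)
        = {g \<in> topspace T. \<forall>x\<in>S. g x = f x}"
      using that(2) by (auto simp: topT PiE_iff extensional_def split: if_splits)
    ultimately show ?thesis by simp
  qed
  have "openin T (topspace T - K)"
  proof (subst openin_subopen, intro ballI)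
    fix f assume "f \<in> topspace T - K"
    then have f: "f \<in> topspace T" "set_of f \<notin> X"
      by (auto simp: K_def)
    then obtain S where S: "finite S" "S \<subseteq> A"
      and notX: "\<And>G. G \<subseteq> A \<Longrightarrow> G \<inter> S = set_of f \<inter> S \<Longrightarrow> G \<notin> X"
      using finitary [of "set_of f"] by (auto simp: set_of_def)
    let ?W = "{g \<in> topspace T. \<forall>x\<in>S. g x = f x}"
    have "set_of g \<notin> X" if "\<forall>x\<in>S. g x = f x" for g
      by (rule notX) (use that in \<open>auto simp: set_of_def\<close>)
    then have "?W \<subseteq> topspace T - K"
      by (auto simp: K_def)
    then show "\<exists>W. openin T W \<and> f \<in> W \<and> W \<subseteq> topspace T - K"
      using cylinder [OF S] f(1) by (intro exI [of _ ?W]) auto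
  qed
  then have "closedin T K"
    by (auto simp: closedin_def K_def)
  moreover have "compact_space T"
    by (simp add: T_def compact_space_product_topology compact_space_discrete_topology)
  ultimately have "compactin T K"
    by (rule closedin_compact_space [rotated])
  then have comp: "compactin (subtopology T K) K"
    by (simp add: compactin_subtopology)
  have topK: "topspace (subtopology T K) = K"
    by (auto simp: K_def)
  have "continuous_map (subtopology T K)
      (closed_subbase_topology X ((\<lambda>x. {F \<in> X. x \<in> F}) ` A)) set_of"
  proof (rule continuous_map_into_closed_subbase_topology)
    show "set_of \<in> topspace (subtopology T K) \<rightarrow> X"
      by (auto simp: K_def)
    fix C assume "C \<in> (\<lambda>x. {F \<in> X. x \<in> F}) ` A"
    then obtain x where x: "x \<in> A" "C = {F \<in> X. x \<in> F}" by blast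
    \<comment> \<open>The codes of sets omitting \<open>x\<close> form a cylinder over
      \<open>{x}\<close>. Its complement, cut down to \<open>K\<close>, is the preimage of the
      subbasic closed set at \<open>x\<close>.\<close>
    have "openin T {g \<in> topspace T. \<forall>y\<in>{x}. g y = False}"
      by (rule cylinder) (use x in auto)
    then have "closedin T (topspace T - {g \<in> topspace T. \<forall>y\<in>{x}. g y = False})"
      by blast
    moreover have "{f \<in> topspace (subtopology T K). set_of f \<in> C}
        = (topspace T - {g \<in> topspace T. \<forall>y\<in>{x}. g y = False}) \<inter> K"
      using x by (auto simp: K_def set_of_def)
    ultimately show "closedin (subtopology T K) {f \<in> topspace (subtopology T K). set_of f \<in> C}"
      by (simp only: closedin_subtopology) blast
  qed
  then have "compactin (closed_subbase_topology X ((\<lambda>x. {F \<in> X. x \<in> F}) ` A)) (set_of ` K)"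
    using comp image_compactin by blast
  moreover have "set_of ` K = X"
  proof
    show "X \<subseteq> set_of ` K"
    proof
      fix F assume F: "F \<in> X"
      \<comment> \<open>Points of the product are undefined off \<open>A\<close>, so the
        characteristic function must be restricted to be one of them.\<close>
      then have "F = set_of (restrict (\<lambda>x. x \<in> F) A)"
        using sub by (auto simp: set_of_def)
      then show "F \<in> set_of ` K"
        using F by (intro image_eqI [of _ _ "restrict (\<lambda>x. x \<in> F) A"]) (auto simp: K_def topT)
    qed
  qed (auto simp: K_def)
  ultimately show ?thesis
    by (simp add: compact_space_def topspace_closed_subbase_topology)
qed

text \<open>A separating clopen set and its complement are disjoint open neighbourhoods of the two
  points.\<close>

lemma totally_disconnected_imp_Hausdorff_space:
  assumes "totally_disconnected_space X"
  shows "Hausdorff_space X"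
  unfolding Hausdorff_space_def
proof (intro allI impI)
  fix x y assume "x \<in> topspace X \<and> y \<in> topspace X \<and> x \<noteq> y"
  then obtain U where "openin X U" "closedin X U" "x \<in> U" "y \<notin> U" "y \<in> topspace X"
    using assms unfolding totally_disconnected_space_def by blast
  then show "\<exists>U V. openin X U \<and> openin X V \<and> x \<in> U \<and> y \<in> V \<and> disjnt U V"
    by (intro exI [of _ U] exI [of _ "topspace X - U"]) (auto simp: disjnt_def)
qed

section \<open>The space of primary filters\<close>

context double_boolean_algebra
begin

text \<open>Writing \<bottom> as the meet of an element with its negation makes both equations of
  the quasi-order instances of idempotence and absorption. The meet equation is proved for all
  \<open>z\<close> because it is used at \<open>y\<close> and at \<bottom> itself.\<close>

lemma bot_le:
  assumes y: "y \<in> carrier D"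
  shows "\<bottom> \<sqsubseteq> y"
proof -
  have meet: "\<bottom> \<sqinter> z = \<bottom>" if z: "z \<in> carrier D" for z
  proof -
    have "\<bottom> \<sqinter> z = z \<sqinter> (z \<sqinter> \<^bold>\<not> z)"
      using z by (simp add: meet_neg meet_comm bot_closed)
    also have "\<dots> = z \<sqinter> \<^bold>\<not> z"
      using z by (simp add: meet_assoc meet_idem_left neg_closed)
    finally show ?thesis
      using z by (simp add: meet_neg)
  qed
  have "\<bottom> \<squnion> y = y \<squnion> (y \<sqinter> \<^bold>\<not> y)"
    using y by (simp add: meet_neg join_comm bot_closed)
  then have "\<bottom> \<squnion> y = y \<squnion> y"
    using y by (simp add: join_meet_absorb neg_closed)
  then show ?thesis
    using meet y by (simp add: dle_def bot_closed)
qed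

lemma filter_proper_iff:
  assumes "dba_filter D F"
  shows "F \<noteq> carrier D \<longleftrightarrow> \<bottom> \<notin> F"
proof -
  have "F \<subseteq> carrier D" "\<And>y. \<bottom> \<in> F \<Longrightarrow> y \<in> carrier D \<Longrightarrow> y \<in> F"
    using assms bot_le unfolding dba_filter_def by blast+
  then show ?thesis
    using bot_closed by blast
qed

text \<open>Properness, a condition on the whole set, becomes a condition on the single element
  \<bottom>. This is what makes every failure to be a primary filter visible on a finite
  set.\<close>

lemma primary_filters_eq:
  "primary_filters D =
    {F. dba_filter D F \<and> \<bottom> \<notin> F \<and> (\<forall>x\<in>carrier D. x \<in> F \<or> \<^bold>\<not> x \<in> F)}"
  unfolding primary_filters_def using filter_proper_iff by blast

text \<open>Primarity gives at least one of the two elements. Both together would put their meet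
  \<bottom> into \<open>F\<close>.\<close>

lemma neg_mem_primary_filter_iff:
  assumes F: "F \<in> primary_filters D" and x: "x \<in> carrier D"
  shows "\<^bold>\<not> x \<in> F \<longleftrightarrow> x \<notin> F"
proof -
  have "x \<sqinter> \<^bold>\<not> x \<in> F" if "x \<in> F" "\<^bold>\<not> x \<in> F"
    using F that by (auto simp: primary_filters_eq dba_filter_def)
  then show ?thesis
    using F x by (auto simp: primary_filters_eq meet_neg)
qed

lemma compact_space_primary_filter_space: "compact_space (primary_filter_space D)"
proof -
  have "compact_space (closed_subbase_topology (primary_filters D)
      ((\<lambda>x. {F \<in> primary_filters D. x \<in> F}) ` carrier D))"
  proof (rule compact_space_set_family)
    show "primary_filters D \<subseteq> Pow (carrier D)"
      by (auto simp: primary_filters_def dba_filter_def)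
    fix F assume F: "F \<subseteq> carrier D" "F \<notin> primary_filters D"
    let ?goal = "\<exists>S. finite S \<and> S \<subseteq> carrier D \<and>
      (\<forall>G. G \<subseteq> carrier D \<longrightarrow> G \<inter> S = F \<inter> S \<longrightarrow> G \<notin> primary_filters D)"
    \<comment> \<open>These are all the ways to fail. In each case \<open>S\<close> consists of the
      elements whose membership shows the failure, so any \<open>G\<close> with the same trace on
      \<open>S\<close> fails in the same way.\<close>
    consider (bot) "\<bottom> \<in> F"
      | (meet) x y where "x \<in> F" "y \<in> F" "x \<sqinter> y \<notin> F"
      | (up) x y where "x \<in> F" "y \<in> carrier D" "x \<sqsubseteq> y" "y \<notin> F"
      | (neg) x where "x \<in> carrier D" "x \<notin> F" "\<^bold>\<not> x \<notin> F"
      using F unfolding primary_filters_eq dba_filter_def by blast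
    then show ?goal
    proof cases
      case bot
      have "G \<notin> primary_filters D" if "G \<inter> {\<bottom>} = F \<inter> {\<bottom>}" for G
      proof -
        have "\<bottom> \<in> G" using bot that by blast
        then show ?thesis by (simp add: primary_filters_eq)
      qed
      then show ?thesis
        using bot_closed by (intro exI [of _ "{\<bottom>}"]) simp
    next
      case meet
      have "G \<notin> primary_filters D" if "G \<inter> {x, y, x \<sqinter> y} = F \<inter> {x, y, x \<sqinter> y}" for G
      proof -
        have "x \<in> G" "y \<in> G" "x \<sqinter> y \<notin> G" using meet that by blast+
        then show ?thesis unfolding primary_filters_eq dba_filter_def by blast
      qed
      moreover have "{x, y, x \<sqinter> y} \<subseteq> carrier D"
        using meet F(1) meet_closed by blast
      ultimately show ?thesis
        by (intro exI [of _ "{x, y, x \<sqinter> y}"]) simp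
    next
      case up
      have "G \<notin> primary_filters D" if "G \<inter> {x, y} = F \<inter> {x, y}" for G
      proof -
        have "x \<in> G" "y \<notin> G" using up that by blast+
        then show ?thesis using up unfolding primary_filters_eq dba_filter_def by blast
      qed
      moreover have "{x, y} \<subseteq> carrier D"
        using up F(1) by blast
      ultimately show ?thesis
        by (intro exI [of _ "{x, y}"]) simp
    next
      case neg
      have "G \<notin> primary_filters D" if "G \<inter> {x, \<^bold>\<not> x} = F \<inter> {x, \<^bold>\<not> x}" for G
      proof -
        have "x \<notin> G" "\<^bold>\<not> x \<notin> G" using neg that by blast+
        then show ?thesis using neg unfolding primary_filters_eq by blast
      qed
      moreover have "{x, \<^bold>\<not> x} \<subseteq> carrier D"
        using neg neg_closed by blast
      ultimately show ?thesis
        by (intro exI [of _ "{x, \<^bold>\<not> x}"]) simp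
    qed
  qed
  then show ?thesis
    by (simp add: primary_filter_space_def primary_filters_at_def [abs_def])
qed

lemma clopen_primary_filters_at:
  assumes x: "x \<in> carrier D"
  shows "closedin (primary_filter_space D) (primary_filters_at D x)"
    and "openin (primary_filter_space D) (primary_filters_at D x)"
proof -
  have cl: "closedin (primary_filter_space D) (primary_filters_at D y)" if "y \<in> carrier D" for y
    unfolding primary_filter_space_def using that
    by (intro closedin_closed_subbase_topology) (auto simp: primary_filters_at_def)
  then show "closedin (primary_filter_space D) (primary_filters_at D x)"
    using x by blast
  \<comment> \<open>Openness comes from negation: the complement of this set is the subbasic closed
    set at the negation of \<open>x\<close>.\<close>
  have "primary_filters_at D x
      = topspace (primary_filter_space D) - primary_filters_at D (\<^bold>\<not> x)"
    using x neg_mem_primary_filter_iff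
    by (auto simp: primary_filters_at_def primary_filter_space_def
        topspace_closed_subbase_topology)
  then show "openin (primary_filter_space D) (primary_filters_at D x)"
    using cl [OF neg_closed [OF x]] by (simp add: openin_diff)
qed

lemma totally_disconnected_primary_filter_space:
  "totally_disconnected_space (primary_filter_space D)"
  unfolding totally_disconnected_space_def
proof (intro ballI impI)
  fix F G assume FG: "F \<in> topspace (primary_filter_space D)"
    "G \<in> topspace (primary_filter_space D)" "F \<noteq> G"
  then have prim: "F \<in> primary_filters D" "G \<in> primary_filters D"
    by (simp_all add: primary_filter_space_def topspace_closed_subbase_topology)
  then have "F \<subseteq> carrier D" "G \<subseteq> carrier D"
    by (auto simp: primary_filters_def dba_filter_def)
  \<comment> \<open>If the element on which \<open>F\<close> and \<open>G\<close> differ lies in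
    \<open>G\<close> only, its negation lies in \<open>F\<close> only and is taken instead.\<close>
  then obtain x where x: "x \<in> carrier D" "x \<in> F" "x \<notin> G"
    using FG(3) neg_mem_primary_filter_iff [OF prim(1)] neg_mem_primary_filter_iff [OF prim(2)]
      neg_closed by blast
  then show "\<exists>U. openin (primary_filter_space D) U \<and> closedin (primary_filter_space D) U \<and>
      F \<in> U \<and> G \<notin> U"
    using clopen_primary_filters_at [OF x(1)] prim
    by (intro exI [of _ "primary_filters_at D x"]) (auto simp: primary_filters_at_def)
qed

end

section \<open>Duality and the space of primary ideals\<close>

definition dual_dba :: "('a, 'm) dba_scheme \<Rightarrow> 'a dba"
  where "dual_dba D = \<lparr>carrier = carrier D, djoin = dmeet D, dmeet = djoin D,
    dneg = dopp D, dopp = dneg D, dtop = dbot D, dbot = dtop D\<rparr>"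

lemma dual_dba_simps [simp]:
  "carrier (dual_dba D) = carrier D"
  "djoin (dual_dba D) = dmeet D"
  "dmeet (dual_dba D) = djoin D"
  "dneg (dual_dba D) = dopp D"
  "dopp (dual_dba D) = dneg D"
  "dtop (dual_dba D) = dbot D"
  "dbot (dual_dba D) = dtop D"
  "dvee (dual_dba D) = dwedge D"
  "dwedge (dual_dba D) = dvee D"
  by (simp_all add: dual_dba_def dvee_def dwedge_def fun_eq_iff)

text \<open>The axioms come in dual pairs, so each goal is literally the partner axiom of
  \<open>D\<close>. Only \<open>meet_join_idem\<close> is its own dual, with its two sides
  exchanged, hence the \<open>symmetric\<close>.\<close>

lemma (in double_boolean_algebra) double_boolean_algebra_dual:
  "double_boolean_algebra (dual_dba D)"
  by (unfold_locales, unfold dual_dba_simps)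
    (fact join_closed meet_closed neg_closed opp_closed top_closed bot_closed
      join_idem_left join_comm join_assoc opp_join_idem join_meet_absorb join_wedge_distrib
      join_wedge_absorb opp_opp_join join_opp opp_top opp_bot
      meet_idem_left meet_comm meet_assoc neg_meet_idem meet_join_absorb meet_vee_distrib
      meet_vee_absorb neg_neg_meet meet_neg neg_bot neg_top meet_join_idem [symmetric])+

lemma (in double_boolean_algebra) primary_filters_dual:
  "primary_filters (dual_dba D) = primary_ideals D"
proof -
  \<comment> \<open>Dualizing swaps the two equations of the quasi-order but leaves the arguments in
    place. Commutativity, available on the carrier, turns them around.\<close>
  have "x \<sqsubseteq>\<^bsub>dual_dba D\<^esub> y \<longleftrightarrow> y \<sqsubseteq> x" if "x \<in> carrier D" "y \<in> carrier D" for x y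
    using that by (auto simp: dle_def join_comm meet_comm)
  then have "(\<forall>x\<in>I. \<forall>y\<in>carrier D. x \<sqsubseteq>\<^bsub>dual_dba D\<^esub> y \<longrightarrow> y \<in> I)
      \<longleftrightarrow> (\<forall>x\<in>I. \<forall>y\<in>carrier D. y \<sqsubseteq> x \<longrightarrow> y \<in> I)" if "I \<subseteq> carrier D" for I
    using that by (intro ball_cong) auto
  then have "dba_filter (dual_dba D) I \<longleftrightarrow> dba_ideal D I" for I
    by (cases "I \<subseteq> carrier D") (simp_all add: dba_filter_def dba_ideal_def)
  then show ?thesis
    by (simp add: primary_filters_def primary_ideals_def)
qed

text \<open>The two spaces are equal, not merely homeomorphic, so results on filters transfer to
  ideals by rewriting.\<close>

lemma (in double_boolean_algebra) primary_filter_space_dual: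
  "primary_filter_space (dual_dba D) = primary_ideal_space D"
  by (simp add: primary_filter_space_def primary_ideal_space_def primary_filters_at_def [abs_def]
      primary_ideals_at_def [abs_def] primary_filters_dual)

theorem mainTheorem17:
  fixes D :: "('a, 'm) dba_scheme"
  assumes "double_boolean_algebra D"
  shows "compact_space (primary_filter_space D) \<and>
         totally_disconnected_space (primary_filter_space D) \<and>
         Hausdorff_space (primary_filter_space D) \<and>
         compact_space (primary_ideal_space D) \<and>
         totally_disconnected_space (primary_ideal_space D) \<and>
         Hausdorff_space (primary_ideal_space D)"
proof -
  interpret double_boolean_algebra D by fact
  interpret dual: double_boolean_algebra "dual_dba D"
    by (rule double_boolean_algebra_dual)
  show ?thesis
    using compact_space_primary_filter_space totally_disconnected_primary_filter_space
      dual.compact_space_primary_filter_space dual.totally_disconnected_primary_filter_space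
    by (simp add: totally_disconnected_imp_Hausdorff_space primary_filter_space_dual)
qed

end
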